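(* Let $M\in\mathcal M$ and $r\in\{\beta,\beta\eta,h\}$. (1) If $M\rhd^*_\eta N$ then $\mathrm{fv}(N)=\mathrm{fv}(M)$ and $d(M)=d(N)$. (2) If $M\rhd^*_rN$ then $\mathrm{fv}(N)\subseteq\mathrm{fv}(M)$ and $d(M)=d(N)$.
   Context: Indexes: finite sequences of natural numbers ($\mathcal L_{\mathbb N}$), $\oslash$ empty, $i::L$ prepending $i$, $L_1\preceq L_2$ (also $L_2\succeq L_1$) iff $L_2=L_1::L_3$ for some $L_3$ (concatenation). Terms: over a countably infinite set $\mathcal V$ of variables, terms $\mathcal M$, free indexed variables $\mathrm{fv}$, degree $d$, joinability $\diamond$ are defined simultaneously: $x^L\in\mathcal M$ ($\mathrm{fv}=\{x^L\}$, $d=L$); $MN\in\mathcal M$ when $d(M)\preceq d(N)$ and $M\diamond N$ ($\mathrm{fv}(MN)=\mathrm{fv}(M)\cup\mathrm{fv}(N)$, $d(MN)=d(M)$); $\lambda x^L.M\in\mathcal M$ when $L\succeq d(M)$ ($\mathrm{fv}=\mathrm{fv}(M)\setminus\{x^L\}$, $d=d(M)$). $M\diamond N$ iff whenever $x^L\in\mathrm{fv}(M)$, $x^K\in\mathrm{fv}(N)$ then $L=K$. Terms modulo $\alpha$-conversion; capture-avoiding substitution $M[x^L:=N]$ defined only if $M\diamond N$ and $d(N)=L$. $\rhd_\beta$: least relation compatible with abstraction and application (when results are terms) containing $(\lambda x^L.M)N\rhd_\beta M[x^L:=N]$ when $d(N)=L$; $\rhd_\eta$: likewise from $\lambda x^L.(Mx^L)\rhd_\eta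 M$ when $x^L\notin\mathrm{fv}(M)$; $\rhd_{\beta\eta}=\rhd_\beta\cup\rhd_\eta$; weak head reduction $(\lambda x^L.M)NN_1\dots N_n\rhd_h M[x^L:=N]N_1\dots N_n$ ($n\ge0$); $\rhd^*_r$ reflexive–transitive closure. *)

theory Defs
  imports "HOL-Library.Sublist" "HOL-Library.Countable" "HOL-Library.Infinite_Typeclass"
begin

type_synonym index = "nat list"

text \<open>
  The order on indexes is \<^const>\<open>prefix\<close>. The indexed variable \<open>x\<^sup>L\<close> is the pair
  \<open>(x, L)\<close>; the binder \<open>PLam x L\<close> binds \<open>x\<^sup>L\<close> only, not \<open>x\<^sup>K\<close> for \<open>K \<noteq> L\<close>.
  The generated set function \<open>names\<close> collects every name that occurs, binders included.
\<close>

datatype (names: 'v) preterm =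
  PVar 'v index
| PApp "'v preterm" "'v preterm"
| PLam 'v index "'v preterm"

primrec pfv :: "'v preterm \<Rightarrow> ('v \<times> index) set" where
  "pfv (PVar x L) = {(x, L)}"
| "pfv (PApp M N) = pfv M \<union> pfv N"
| "pfv (PLam x L M) = pfv M - {(x, L)}"

primrec pdeg :: "'v preterm \<Rightarrow> index" where
  "pdeg (PVar x L) = L"
| "pdeg (PApp M N) = pdeg M"
| "pdeg (PLam x L M) = pdeg M"

definition joinable :: "'v preterm \<Rightarrow> 'v preterm \<Rightarrow> bool" (infix \<open>\<diamond>\<close> 50) where
  "M \<diamond> N \<longleftrightarrow> (\<forall>x L K. (x, L) \<in> pfv M \<longrightarrow> (x, K) \<in> pfv N \<longrightarrow> L = K)"

inductive_set terms :: "'v preterm set" where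
  Var: "PVar x L \<in> terms"
| App: "\<lbrakk>M \<in> terms; N \<in> terms; prefix (pdeg M) (pdeg N); M \<diamond> N\<rbrakk> \<Longrightarrow> PApp M N \<in> terms"
| Lam: "\<lbrakk>M \<in> terms; prefix (pdeg M) L\<rbrakk> \<Longrightarrow> PLam x L M \<in> terms"

text \<open>
  Alpha-conversion is generated by change of bound variable: \<open>\<lambda>x\<^sup>L.M\<close> becomes
  \<open>\<lambda>y\<^sup>L.M[x\<^sup>L := y\<^sup>L]\<close>, where the name \<open>y\<close> does not occur in \<open>M\<close> under any index, so
  that textual replacement of the free occurrences of \<open>x\<^sup>L\<close> does not capture. It has to be
  restricted to \<^const>\<open>terms\<close>: for \<open>L \<noteq> K\<close>, \<open>\<lambda>x\<^sup>L. x\<^sup>L x\<^sup>K\<close> violates joinability but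
  \<open>\<lambda>y\<^sup>L. y\<^sup>L x\<^sup>K\<close> does not.
\<close>

primrec rename :: "'v \<Rightarrow> index \<Rightarrow> 'v \<Rightarrow> 'v preterm \<Rightarrow> 'v preterm" where
  "rename x L y (PVar z K) = (if (z, K) = (x, L) then PVar y L else PVar z K)"
| "rename x L y (PApp M N) = PApp (rename x L y M) (rename x L y N)"
| "rename x L y (PLam z K M) =
     (if (z, K) = (x, L) then PLam z K M else PLam z K (rename x L y M))"

inductive alpha :: "'v preterm \<Rightarrow> 'v preterm \<Rightarrow> bool" where
  alpha_refl: "M \<in> terms \<Longrightarrow> alpha M M"
| alpha_sym: "alpha M N \<Longrightarrow> alpha N M"
| alpha_trans: "\<lbrakk>alpha M N; alpha N P\<rbrakk> \<Longrightarrow> alpha M P"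
| alpha_App: "\<lbrakk>alpha M M'; alpha N N'; PApp M N \<in> terms\<rbrakk> \<Longrightarrow> alpha (PApp M N) (PApp M' N')"
| alpha_Lam: "\<lbrakk>alpha M M'; PLam x L M \<in> terms\<rbrakk> \<Longrightarrow> alpha (PLam x L M) (PLam x L M')"
| alpha_rename: "\<lbrakk>PLam x L M \<in> terms; y \<notin> names M\<rbrakk>
    \<Longrightarrow> alpha (PLam x L M) (PLam y L (rename x L y M))"

inductive_cases terms_AppE: "PApp M N \<in> terms"
inductive_cases terms_LamE: "PLam x L M \<in> terms"

lemma pfv_names: "(x, L) \<in> pfv M \<Longrightarrow> x \<in> names M"
  by (induction M) auto

lemma pdeg_rename [simp]: "pdeg (rename x L y M) = pdeg M"
  by (induction M) auto

lemma pfv_rename: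
  "y \<notin> names M \<Longrightarrow> pfv (rename x L y M) = (\<lambda>v. if v = (x, L) then (y, L) else v) ` pfv M"
proof (induction M)
  case (PLam z K M)
  let ?f = "\<lambda>v. if v = (x, L) then (y, L) else v"
  have "y \<noteq> z"
    using PLam.prems by auto
  then have f: "?f v = (z, K) \<longleftrightarrow> v = (z, K)" if "(z, K) \<noteq> (x, L)" for v
    using that by (cases "v = (x, L)") auto
  show ?case
  proof (cases "(z, K) = (x, L)")
    case True
    then have "?f ` (pfv M - {(z, K)}) = id ` (pfv M - {(z, K)})"
      by (intro image_cong) auto
    with True show ?thesis by simp
  next
    case False
    have "g ` S - {c} = g ` (S - {c})" if "\<And>v. g v = c \<longleftrightarrow> v = c"
      for g :: "'a \<times> index \<Rightarrow> 'a \<times> index" and S c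
      using that by blast
    note eq = this[OF f[OF False]]
    have "rename x L y (PLam z K M) = PLam z K (rename x L y M)"
      using False by auto
    moreover have "pfv (rename x L y M) = ?f ` pfv M"
      using PLam by simp
    ultimately show ?thesis
      by (simp only: pfv.simps eq)
  qed
next
  case (PApp M N)
  then show ?case
    by (simp add: image_Un del: if_image_distrib)
qed simp

lemma rename_terms: "\<lbrakk>M \<in> terms; y \<notin> names M\<rbrakk> \<Longrightarrow> rename x L y M \<in> terms"
proof (induction M rule: terms.induct)
  case (App M N)
  have fresh: "(y, K) \<notin> pfv M" "(y, K) \<notin> pfv N" for K
    using App.prems pfv_names[of y K M] pfv_names[of y K N] by auto
  have "rename x L y M \<diamond> rename x L y N"
    unfolding joinable_def
  proof (intro allI impI)
    fix z K K'
    assume "(z, K) \<in> pfv (rename x L y M)" "(z, K') \<in> pfv (rename x L y N)"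
    then obtain v w where "v \<in> pfv M" "(z, K) = (if v = (x, L) then (y, L) else v)"
        "w \<in> pfv N" "(z, K') = (if w = (x, L) then (y, L) else w)"
      using App.prems by (auto simp: pfv_rename simp del: split_paired_Ex)
    then show "K = K'"
      using App.hyps(4) fresh unfolding joinable_def by (metis prod.inject)
  qed
  then show ?case
    using App by (simp add: terms.App)
next
  case (Lam M K z)
  then show ?case
    using terms.Lam[of M K z] terms.Lam[of "rename x L y M" K z] by auto
qed (simp add: terms.Var)

lemma alpha_invariants:
  "alpha M N \<Longrightarrow> M \<in> terms \<and> N \<in> terms \<and> pfv M = pfv N \<and> pdeg M = pdeg N"
proof (induction rule: alpha.induct)
  case (alpha_App M M' N N')
  then show ?case
    by (elim terms_AppE) (simp add: joinable_def terms.App)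
next
  case (alpha_Lam M M' x L)
  then show ?case
    by (auto intro!: terms.Lam elim!: terms_LamE)
next
  case (alpha_rename x L M y)
  let ?f = "\<lambda>v. if v = (x, L) then (y, L) else v"
  have "(y, L) \<notin> pfv M"
    using alpha_rename pfv_names[of y L M] by auto
  then have "?f ` pfv M - {(y, L)} = id ` (pfv M - {(x, L)})"
    by (intro equalityI subsetI) (force split: if_splits simp del: split_paired_Ex split_paired_All)+
  then have "pfv (PLam x L M) = pfv (PLam y L (rename x L y M))"
    using alpha_rename by (simp add: pfv_rename)
  moreover have "M \<in> terms" "prefix (pdeg M) L"
    using alpha_rename(1) by (auto elim: terms_LamE)
  ultimately show ?case
    using alpha_rename rename_terms[of M y x L] by (simp add: terms.Lam)
qed auto

quotient_type 'v lterm = "'v preterm" / partial: alpha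
  morphisms rep_lterm abs_lterm
proof (rule part_equivpI)
  show "\<exists>M :: 'v preterm. alpha M M"
    by (blast intro: alpha_refl terms.Var)
  show "symp (alpha :: 'v preterm \<Rightarrow> _)"
    by (blast intro: sympI alpha_sym)
  show "transp (alpha :: 'v preterm \<Rightarrow> _)"
    by (blast intro: transpI alpha_trans)
qed

lift_definition fv :: "'v lterm \<Rightarrow> ('v \<times> index) set" is pfv
  using alpha_invariants by blast

lift_definition deg :: "'v lterm \<Rightarrow> index" is pdeg
  using alpha_invariants by blast

text \<open>
  Capture-avoiding substitution is the instance \<open>\<sigma> = id[x\<^sup>L := N]\<close> of simultaneous
  substitution, which renames every bound variable it passes. The new name is fresh
  regardless of index, as otherwise joinability could be lost. The side conditions
  \<open>M \<diamond> N\<close> and \<open>d(N) = L\<close> for \<open>M[x\<^sup>L := N]\<close> to be defined are premises wherever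
  \<open>psubst\<close> is used.
\<close>

definition fresh_name :: "('v \<times> index) set \<Rightarrow> 'v" where
  "fresh_name S = (SOME z. \<forall>K. (z, K) \<notin> S)"

primrec psubsts :: "'v preterm \<Rightarrow> ('v \<times> index \<Rightarrow> 'v preterm) \<Rightarrow> 'v preterm" where
  "psubsts (PVar x L) \<sigma> = \<sigma> (x, L)"
| "psubsts (PApp M N) \<sigma> = PApp (psubsts M \<sigma>) (psubsts N \<sigma>)"
| "psubsts (PLam y K M) \<sigma> =
     (let z = fresh_name (\<Union>v \<in> pfv (PLam y K M). pfv (\<sigma> v))
      in PLam z K (psubsts M (\<sigma>((y, K) := PVar z K))))"

definition psubst :: "'v preterm \<Rightarrow> 'v \<Rightarrow> index \<Rightarrow> 'v preterm \<Rightarrow> 'v preterm" where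
  "psubst M x L N = psubsts M ((\<lambda>(y, K). PVar y K)((x, L) := N))"

inductive beta_contr :: "'v preterm \<Rightarrow> 'v preterm \<Rightarrow> bool" where
  "\<lbrakk>M \<diamond> N; pdeg N = L\<rbrakk> \<Longrightarrow> beta_contr (PApp (PLam x L M) N) (psubst M x L N)"

inductive eta_contr :: "'v preterm \<Rightarrow> 'v preterm \<Rightarrow> bool" where
  "(x, L) \<notin> pfv M \<Longrightarrow> eta_contr (PLam x L (PApp M (PVar x L))) M"

inductive whead_contr :: "'v preterm \<Rightarrow> 'v preterm \<Rightarrow> bool" where
  "\<lbrakk>M \<diamond> N; pdeg N = L\<rbrakk>
    \<Longrightarrow> whead_contr (foldl PApp (PApp (PLam x L M) N) Ns) (foldl PApp (psubst M x L N) Ns)"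

inductive compat :: "('v preterm \<Rightarrow> 'v preterm \<Rightarrow> bool) \<Rightarrow> 'v preterm \<Rightarrow> 'v preterm \<Rightarrow> bool"
  for R where
  base: "\<lbrakk>R M N; M \<in> terms; N \<in> terms\<rbrakk> \<Longrightarrow> compat R M N"
| Lam: "\<lbrakk>compat R M N; PLam x L M \<in> terms; PLam x L N \<in> terms\<rbrakk>
    \<Longrightarrow> compat R (PLam x L M) (PLam x L N)"
| AppL: "\<lbrakk>compat R M N; PApp M P \<in> terms; PApp N P \<in> terms\<rbrakk>
    \<Longrightarrow> compat R (PApp M P) (PApp N P)"
| AppR: "\<lbrakk>compat R M N; PApp P M \<in> terms; PApp P N \<in> terms\<rbrakk>
    \<Longrightarrow> compat R (PApp P M) (PApp P N)"

text \<open>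
  A relation on raw terms acts on alpha-classes through representatives. In particular, a
  redex whose bound name clashes with its argument (\<open>M \<diamond> N\<close> fails) is contracted via another
  representative.
\<close>

definition mod_alpha :: "('v preterm \<Rightarrow> 'v preterm \<Rightarrow> bool) \<Rightarrow> 'v lterm \<Rightarrow> 'v lterm \<Rightarrow> bool" where
  "mod_alpha R A B \<longleftrightarrow>
     (\<exists>M \<in> terms. \<exists>N \<in> terms. A = abs_lterm M \<and> B = abs_lterm N \<and> R M N)"

definition beta :: "'v lterm \<Rightarrow> 'v lterm \<Rightarrow> bool" where
  "beta = mod_alpha (compat beta_contr)"

definition eta :: "'v lterm \<Rightarrow> 'v lterm \<Rightarrow> bool" where
  "eta = mod_alpha (compat eta_contr)"

definition beta_eta :: "'v lterm \<Rightarrow> 'v lterm \<Rightarrow> bool" where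
  "beta_eta = sup beta eta"

definition whead :: "'v lterm \<Rightarrow> 'v lterm \<Rightarrow> bool" where
  "whead = mod_alpha whead_contr"

end

theory Submission
  imports Defs
begin

text \<open>Both claims reduce to one contraction at the root of a raw term, since the two
  invariants pass through term contexts, representatives of alpha-classes and reduction sequences.
  For a beta or weak head redex, \<open>pfv_psubst_subset\<close> gives the inclusion; it may be
  strict, because the argument vanishes when the bound variable does not occur. The degree of a term
  is the index of its head variable, and replacing a variable of index \<open>L\<close> by a term of
  degree \<open>L\<close> keeps it (\<open>pdeg_psubst\<close>). Eta contraction removes only
  occurrences of a bound variable, hence equality there.\<close>

lemma pfv_psubsts_subset: "pfv (psubsts M \<sigma>) \<subseteq> (\<Union>v \<in> pfv M. pfv (\<sigma> v))"
proof (induction M arbitrary: \<sigma>)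
  case (PLam y K M)
  define z where "z = fresh_name (\<Union>v \<in> pfv (PLam y K M). pfv (\<sigma> v))"
  have "pfv (psubsts M (\<sigma>((y, K) := PVar z K)))
      \<subseteq> (\<Union>v \<in> pfv M. pfv ((\<sigma>((y, K) := PVar z K)) v))"
    by (rule PLam.IH)
  \<comment> \<open>Only the updated point \<open>(y, K)\<close> can contribute
    \<open>(z, K)\<close>, and the new binder \<open>PLam z K\<close> removes exactly this variable
    again.\<close>
  also have "\<dots> \<subseteq> (\<Union>v \<in> pfv M - {(y, K)}. pfv (\<sigma> v)) \<union> {(z, K)}"
    by (auto split: if_splits)
  finally show ?case
    by (auto simp: Let_def z_def)
next
  case (PApp M N)
  show ?case
    using PApp.IH(1)[of \<sigma>] PApp.IH(2)[of \<sigma>] by auto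
qed simp

text \<open>The assumption on \<open>\<sigma>\<close> survives passing a binder, because the update
  sends \<open>(y, K)\<close> to a variable of the same index \<open>K\<close>.\<close>

lemma pdeg_psubsts:
  assumes "\<And>v. pdeg (\<sigma> v) = snd v"
  shows "pdeg (psubsts M \<sigma>) = pdeg M"
  using assms by (induction M arbitrary: \<sigma>) (simp_all add: Let_def)

lemma pfv_psubst_subset: "pfv (psubst M x L N) \<subseteq> (pfv M - {(x, L)}) \<union> pfv N"
  using pfv_psubsts_subset[of M "(\<lambda>(y, K). PVar y K)((x, L) := N)"]
  unfolding psubst_def by (auto split: if_splits)

lemma pdeg_psubst: "pdeg N = L \<Longrightarrow> pdeg (psubst M x L N) = pdeg M"
  unfolding psubst_def by (rule pdeg_psubsts) auto

lemma pfv_foldl_PApp: "pfv (foldl PApp M Ns) = pfv M \<union> \<Union> (pfv ` set Ns)"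
  by (induction Ns arbitrary: M) auto

lemma pdeg_foldl_PApp: "pdeg (foldl PApp M Ns) = pdeg M"
  by (induction Ns arbitrary: M) auto

lemma beta_contr_pfv_pdeg: "beta_contr M N \<Longrightarrow> pfv N \<subseteq> pfv M \<and> pdeg M = pdeg N"
  by (erule beta_contr.cases) (auto simp: pdeg_psubst dest!: subsetD[OF pfv_psubst_subset])

text \<open>The arguments \<open>Ns\<close> add the same free variables to both sides, and the
  degree is read off at the head, so this is the beta case again.\<close>

lemma whead_contr_pfv_pdeg: "whead_contr M N \<Longrightarrow> pfv N \<subseteq> pfv M \<and> pdeg M = pdeg N"
  by (erule whead_contr.cases)
    (auto simp: pdeg_psubst pfv_foldl_PApp pdeg_foldl_PApp
      dest!: subsetD[OF pfv_psubst_subset])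

lemma eta_contr_pfv_pdeg: "eta_contr M N \<Longrightarrow> pfv N = pfv M \<and> pdeg M = pdeg N"
  by (erule eta_contr.cases) auto

text \<open>Union and removal of a variable are monotone, and the degree of a compound term is that
  of its function part or body.\<close>

lemma compat_pfv_subset_pdeg:
  assumes "compat R M N" and "\<And>M N. R M N \<Longrightarrow> pfv N \<subseteq> pfv M \<and> pdeg M = pdeg N"
  shows "pfv N \<subseteq> pfv M \<and> pdeg M = pdeg N"
  using assms(1) by induction (use assms(2) in auto)

lemma compat_pfv_eq_pdeg:
  assumes "compat R M N" and "\<And>M N. R M N \<Longrightarrow> pfv N = pfv M \<and> pdeg M = pdeg N"
  shows "pfv N = pfv M \<and> pdeg M = pdeg N"
  using assms(1) by induction (use assms(2) in auto)

text \<open>Transfers facts about raw terms to alpha-classes: representatives lie in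
  \<open>terms\<close>, so \<open>alpha_refl\<close> lets \<open>fv\<close> and \<open>deg\<close>
  be computed on them.\<close>

lemma mod_alphaE:
  assumes "mod_alpha R A B"
  obtains M N where "R M N" "fv A = pfv M" "fv B = pfv N" "deg A = pdeg M" "deg B = pdeg N"
  using assms unfolding mod_alpha_def by (metis alpha_refl deg.abs_eq fv.abs_eq)

lemma beta_fv_deg: "beta A B \<Longrightarrow> fv B \<subseteq> fv A \<and> deg A = deg B"
  unfolding beta_def
  by (elim mod_alphaE) (use compat_pfv_subset_pdeg[OF _ beta_contr_pfv_pdeg] in metis)

lemma eta_fv_deg: "eta A B \<Longrightarrow> fv B = fv A \<and> deg A = deg B"
  unfolding eta_def
  by (elim mod_alphaE) (use compat_pfv_eq_pdeg[OF _ eta_contr_pfv_pdeg] in metis)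

lemma whead_fv_deg: "whead A B \<Longrightarrow> fv B \<subseteq> fv A \<and> deg A = deg B"
  unfolding whead_def by (elim mod_alphaE) (use whead_contr_pfv_pdeg in metis)

lemma beta_eta_fv_deg: "beta_eta A B \<Longrightarrow> fv B \<subseteq> fv A \<and> deg A = deg B"
  unfolding beta_eta_def using beta_fv_deg eta_fv_deg by fastforce

theorem theorem1:
  fixes M N :: "'v::{countable, infinite} lterm"
    and r :: "'v lterm \<Rightarrow> 'v lterm \<Rightarrow> bool"
  assumes "r \<in> {beta, beta_eta, whead}"
  shows "(eta\<^sup>*\<^sup>* M N \<longrightarrow> fv N = fv M \<and> deg M = deg N)
       \<and> (r\<^sup>*\<^sup>* M N \<longrightarrow> fv N \<subseteq> fv M \<and> deg M = deg N)"
proof (intro conjI[of "_ \<longrightarrow> _"] impI)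
  assume "eta\<^sup>*\<^sup>* M N"
  then show "fv N = fv M \<and> deg M = deg N"
    by induction (use eta_fv_deg in metis)+
next
  \<comment> \<open>The three choices of \<open>r\<close> share this one-step property, so a single
    induction on the closure serves them all.\<close>
  have step: "fv B \<subseteq> fv A \<and> deg A = deg B" if "r A B" for A B
    using assms that beta_fv_deg beta_eta_fv_deg whead_fv_deg by blast
  assume "r\<^sup>*\<^sup>* M N"
  then show "fv N \<subseteq> fv M \<and> deg M = deg N"
    by induction (use step in fastforce)+
qed

end
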